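(* Let $(X,d_1)$, $(Y,d_2)$ be two metric spaces and let $(X,f_{1,\infty})$, $(Y,g_{1,\infty})$ be two non-autonomous systems such that $f_{1,\infty}$ is topologically semi-conjugate to $g_{1,\infty}$, i.e. there is a continuous surjective map $h:X\to Y$ with $h\circ f_n=g_n\circ h$ for every $n\in\mathbb{N}$. If $f_{1,\infty}$ has the strong specification property (SSP), then $g_{1,\infty}$ also has SSP.
   Context: A non-autonomous (discrete) system $(X,f_{1,\infty})$ consists of a compact metric space $(X,d)$ and a sequence $f_{1,\infty}=(f_n)_{n\ge 1}$ of continuous surjective maps $f_n:X\to X$ (so both metric spaces in the claim are compact). Write $\mathbb{N}=\{1,2,\dots\}$, $f_1^0=\mathrm{id}$ and $f_1^n=f_n\circ\cdots\circ f_1$ for $n\ge1$. A point $z$ is periodic with period $p\in\mathbb{N}$ if $f_1^{pm}(z)=z$ for every $m\in\mathbb{N}$ ($p$ need not be minimal). $(X,f_{1,\infty})$ has the strong specification property (SSP) if for every $\epsilon>0$ there is a positive integer $M(\epsilon)$ such that for every $s\in\mathbb{N}$, every choice of points $x_1,\dots,x_s\in X$, every sequence $a_1\le b_1<a_2\le b_2<\cdots<a_s\le b_s$ of non-negative integers with $a_j-b_{j-1}>M(\epsilon)$ for $2\le j\le s$, and every integer $p>M(\epsilon)+b_s-a_1$, there is a periodic point $z\in X$ with period $p$ such that $d(f_1^j(z),f_1^j(x_i))<\epsilon$ for all $a_i\le j\le b_i$, $1\le i\le s$. *)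

theory Defs
  imports "HOL-Analysis.Analysis"
begin

text \<open>Sequences of maps are indexed from 1: a sequence is a function on \<^typ>\<open>nat\<close> whose value
  at 0 is never used. Maps are constrained and compared on the underlying sets only.\<close>

definition nonautonomous_system :: "'a metric \<Rightarrow> (nat \<Rightarrow> 'a \<Rightarrow> 'a) \<Rightarrow> bool" where
  "nonautonomous_system X f \<longleftrightarrow>
     compact_space (mtopology_of X) \<and>
     (\<forall>n\<ge>1. continuous_map (mtopology_of X) (mtopology_of X) (f n) \<and>
             f n ` mspace X = mspace X)"

primrec iter :: "(nat \<Rightarrow> 'a \<Rightarrow> 'a) \<Rightarrow> nat \<Rightarrow> 'a \<Rightarrow> 'a" where
  "iter f 0 = id"
| "iter f (Suc n) = f (Suc n) \<circ> iter f n"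

definition periodic_point :: "'a metric \<Rightarrow> (nat \<Rightarrow> 'a \<Rightarrow> 'a) \<Rightarrow> nat \<Rightarrow> 'a \<Rightarrow> bool" where
  "periodic_point X f p z \<longleftrightarrow>
     z \<in> mspace X \<and> p \<ge> 1 \<and> (\<forall>m\<ge>1. iter f (p * m) z = z)"

text \<open>The subtractions on \<^typ>\<open>nat\<close> below agree with those on the integers, because of the
  ordering assumptions on \<open>a\<close> and \<open>b\<close>.\<close>

definition strong_specification :: "'a metric \<Rightarrow> (nat \<Rightarrow> 'a \<Rightarrow> 'a) \<Rightarrow> bool" where
  "strong_specification X f \<longleftrightarrow>
     (\<forall>\<epsilon>::real. \<epsilon> > 0 \<longrightarrow>
       (\<exists>M::nat. M > 0 \<and>
         (\<forall>(s::nat) (x :: nat \<Rightarrow> 'a) (a :: nat \<Rightarrow> nat) (b :: nat \<Rightarrow> nat) (p::nat).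
            s \<ge> 1 \<longrightarrow>
            (\<forall>i\<in>{1..s}. x i \<in> mspace X) \<longrightarrow>
            (\<forall>i\<in>{1..s}. a i \<le> b i) \<longrightarrow>
            (\<forall>j\<in>{2..s}. b (j - 1) < a j) \<longrightarrow>
            (\<forall>j\<in>{2..s}. a j - b (j - 1) > M) \<longrightarrow>
            p > M + b s - a 1 \<longrightarrow>
            (\<exists>z. periodic_point X f p z \<and>
                 (\<forall>i\<in>{1..s}. \<forall>j\<in>{a i..b i}.
                    mdist X (iter f j z) (iter f j (x i)) < \<epsilon>)))))"

definition semi_conjugacy ::
  "'a metric \<Rightarrow> (nat \<Rightarrow> 'a \<Rightarrow> 'a) \<Rightarrow> 'b metric \<Rightarrow> (nat \<Rightarrow> 'b \<Rightarrow> 'b) \<Rightarrow> ('a \<Rightarrow> 'b) \<Rightarrow> bool" where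
  "semi_conjugacy X f Y g h \<longleftrightarrow>
     continuous_map (mtopology_of X) (mtopology_of Y) h \<and>
     h ` mspace X = mspace Y \<and>
     (\<forall>n\<ge>1. \<forall>x\<in>mspace X. h (f n x) = g n (h x))"

definition semi_conjugate ::
  "'a metric \<Rightarrow> (nat \<Rightarrow> 'a \<Rightarrow> 'a) \<Rightarrow> 'b metric \<Rightarrow> (nat \<Rightarrow> 'b \<Rightarrow> 'b) \<Rightarrow> bool" where
  "semi_conjugate X f Y g \<longleftrightarrow> (\<exists>h. semi_conjugacy X f Y g h)"

end

theory Submission
  imports Defs
begin

text \<open>By compactness the factor map \<open>h\<close> is uniformly continuous, so the constant \<open>M(\<delta>)\<close> of the
  upper system serves for \<open>\<epsilon>\<close> in the lower one: lift the prescribed points through \<open>h\<close>, trace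
  the lifts within \<open>\<delta>\<close> by a periodic point \<open>z\<close>, and project \<open>z\<close> back down.\<close>

text \<open>Needed because \<open>h (f n x) = g n (h x)\<close> is available only for
  \<open>x\<close> in \<open>mspace X\<close>: orbits must stay there for the relation to be
  iterated.\<close>

lemma iter_mem:
  assumes "nonautonomous_system X f" and "x \<in> mspace X"
  shows "iter f n x \<in> mspace X"
  using assms by (induction n) (auto simp: nonautonomous_system_def)

lemma semi_conjugacy_iter:
  assumes "nonautonomous_system X f" and "semi_conjugacy X f Y g h" and "x \<in> mspace X"
  shows "h (iter f n x) = iter g n (h x)"
proof (induction n)
  case (Suc n)
  then show ?case
    using assms iter_mem[OF assms(1,3), of n] by (simp add: semi_conjugacy_def)
qed simp

lemma semi_conjugacy_periodic_point:
  assumes "nonautonomous_system X f" and "semi_conjugacy X f Y g h" and "periodic_point X f p z"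
  shows "periodic_point Y g p (h z)"
  using assms semi_conjugacy_iter[OF assms(1,2), of z]
  unfolding periodic_point_def semi_conjugacy_def by (metis image_eqI)

text \<open>The matrix of \<open>strong_specification\<close> with tolerance and gap as parameters,
  so that the transfer along \<open>h\<close> can be stated for one fixed pair of tolerances and a
  common \<open>M\<close>.\<close>

definition specification_gap ::
  "'a metric \<Rightarrow> (nat \<Rightarrow> 'a \<Rightarrow> 'a) \<Rightarrow> real \<Rightarrow> nat \<Rightarrow> bool" where
  "specification_gap X f \<epsilon> M \<longleftrightarrow>
     (\<forall>(s::nat) (x :: nat \<Rightarrow> 'a) (a :: nat \<Rightarrow> nat) (b :: nat \<Rightarrow> nat) (p::nat).
        s \<ge> 1 \<longrightarrow>
        (\<forall>i\<in>{1..s}. x i \<in> mspace X) \<longrightarrow>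
        (\<forall>i\<in>{1..s}. a i \<le> b i) \<longrightarrow>
        (\<forall>j\<in>{2..s}. b (j - 1) < a j) \<longrightarrow>
        (\<forall>j\<in>{2..s}. a j - b (j - 1) > M) \<longrightarrow>
        p > M + b s - a 1 \<longrightarrow>
        (\<exists>z. periodic_point X f p z \<and>
             (\<forall>i\<in>{1..s}. \<forall>j\<in>{a i..b i}. mdist X (iter f j z) (iter f j (x i)) < \<epsilon>)))"

lemma strong_specification_iff_gap:
  "strong_specification X f \<longleftrightarrow> (\<forall>\<epsilon>>0. \<exists>M>0. specification_gap X f \<epsilon> M)"
  unfolding strong_specification_def specification_gap_def by (rule refl)

text \<open>Projection by \<open>h\<close> alters neither the times \<open>a\<close>,
  \<open>b\<close> nor the period \<open>p\<close>, so \<open>M\<close> is kept and only the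
  tolerance changes, from \<delta> to \<epsilon>.\<close>

lemma semi_conjugacy_specification_gap:
  assumes f: "nonautonomous_system X f" and h: "semi_conjugacy X f Y g h"
    and gap: "specification_gap X f \<delta> M"
    and \<delta>: "\<And>u v. \<lbrakk>u \<in> mspace X; v \<in> mspace X; mdist X u v < \<delta>\<rbrakk> \<Longrightarrow> mdist Y (h u) (h v) < \<epsilon>"
  shows "specification_gap Y g \<epsilon> M"
  unfolding specification_gap_def
proof (intro allI impI)
  fix s :: nat and y :: "nat \<Rightarrow> 'b" and a b :: "nat \<Rightarrow> nat" and p :: nat
  assume s: "s \<ge> 1"
    and y: "\<forall>i\<in>{1..s}. y i \<in> mspace Y"
    and ab: "\<forall>i\<in>{1..s}. a i \<le> b i"
    and ba: "\<forall>j\<in>{2..s}. b (j - 1) < a j"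
    and M: "\<forall>j\<in>{2..s}. a j - b (j - 1) > M"
    and p: "p > M + b s - a 1"
  \<comment> \<open>Surjectivity of \<open>h\<close> gives a preimage of each prescribed point; any
    choice of preimages will do.\<close>
  have "\<forall>i\<in>{1..s}. \<exists>u. u \<in> mspace X \<and> h u = y i"
    using y h unfolding semi_conjugacy_def by (metis imageE)
  then obtain x where x: "\<forall>i\<in>{1..s}. x i \<in> mspace X \<and> h (x i) = y i"
    by (rule bchoice[THEN exE])
  then have "\<forall>i\<in>{1..s}. x i \<in> mspace X"
    by blast
  from gap[unfolded specification_gap_def, rule_format (no_asm), OF s this ab ba M p]
  obtain z where z: "periodic_point X f p z"
    and close: "\<forall>i\<in>{1..s}. \<forall>j\<in>{a i..b i}. mdist X (iter f j z) (iter f j (x i)) < \<delta>"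
    by blast
  have zX: "z \<in> mspace X"
    using z by (simp add: periodic_point_def)
  have "mdist Y (iter g j (h z)) (iter g j (y i)) < \<epsilon>"
    if i: "i \<in> {1..s}" and j: "j \<in> {a i..b i}" for i j
  proof -
    have xi: "x i \<in> mspace X" "h (x i) = y i"
      using x i by auto
    \<comment> \<open>The modulus \<delta> is applied to the two orbit points at time
      \<open>j\<close>, not to \<open>z\<close> and \<open>x i\<close> themselves.\<close>
    have "mdist Y (h (iter f j z)) (h (iter f j (x i))) < \<epsilon>"
      using close i j by (intro \<delta> iter_mem[OF f] zX xi(1)) blast
    then show ?thesis
      using semi_conjugacy_iter[OF f h] zX xi by simp
  qed
  then show "\<exists>z. periodic_point Y g p z \<and>
      (\<forall>i\<in>{1..s}. \<forall>j\<in>{a i..b i}. mdist Y (iter g j z) (iter g j (y i)) < \<epsilon>)"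
    using semi_conjugacy_periodic_point[OF f h z] by blast
qed

theorem theorem3p2:
  fixes X :: "'a metric" and f :: "nat \<Rightarrow> 'a \<Rightarrow> 'a"
    and Y :: "'b metric" and g :: "nat \<Rightarrow> 'b \<Rightarrow> 'b"
  assumes "nonautonomous_system X f"
    and "nonautonomous_system Y g"
    and "semi_conjugate X f Y g"
    and "strong_specification X f"
  shows "strong_specification Y g"
  unfolding strong_specification_iff_gap
proof (intro allI impI)
  fix \<epsilon> :: real
  assume "\<epsilon> > 0"
  obtain h where h: "semi_conjugacy X f Y g h"
    using assms(3) by (auto simp: semi_conjugate_def)
  \<comment> \<open>Heine-Cantor, from compactness of \<open>X\<close>: one \<delta> must serve
    along entire orbit segments, wherever they lie.\<close>
  have "uniformly_continuous_map X Y h"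
    using assms(1) h
    by (intro continuous_imp_uniformly_continuous_map)
       (simp add: nonautonomous_system_def semi_conjugacy_def)
  then obtain \<delta> where "\<delta> > 0"
    and \<delta>: "\<And>u v. \<lbrakk>u \<in> mspace X; v \<in> mspace X; mdist X u v < \<delta>\<rbrakk> \<Longrightarrow> mdist Y (h u) (h v) < \<epsilon>"
    using \<open>\<epsilon> > 0\<close> unfolding uniformly_continuous_map_def by meson
  obtain M where "M > 0" "specification_gap X f \<delta> M"
    using assms(4) \<open>\<delta> > 0\<close> unfolding strong_specification_iff_gap by blast
  then show "\<exists>M>0. specification_gap Y g \<epsilon> M"
    using semi_conjugacy_specification_gap[OF assms(1) h _ \<delta>] by blast
qed

end
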